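(* Let $A$ and $B$ be two nontrivial, finitely generated, orderable groups. There exists no order on the free product $G = A*B$ such that its positive cone is finitely generated as a semigroup.
   Context: An order on a group $G$ means a total left order: a total order $\leq$ on $G$ such that $g \leq g'$ implies $hg \leq hg'$ for all $g, g', h \in G$. A group is orderable if it admits an order. The positive cone of an ordered group $(G,\leq)$ is $G_+ = \{g \in G \mid e < g\}$, where $e$ is the identity element of $G$; it is a subsemigroup of $G$. *)

theory Defs
  imports "HOL-Algebra.Generated_Groups"
begin

section \<open>Orders on groups\<close>

text \<open>An order is a reflexive relation on the carrier; only invariance under left
  multiplication is required.\<close>

definition group_order :: "('a, 'm) monoid_scheme \<Rightarrow> ('a \<times> 'a) set \<Rightarrow> bool" where
  "group_order G r \<longleftrightarrow>
     linear_order_on (carrier G) r \<and>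
     (\<forall>g \<in> carrier G. \<forall>g' \<in> carrier G. \<forall>h \<in> carrier G.
        (g, g') \<in> r \<longrightarrow> (h \<otimes>\<^bsub>G\<^esub> g, h \<otimes>\<^bsub>G\<^esub> g') \<in> r)"

definition orderable :: "('a, 'm) monoid_scheme \<Rightarrow> bool" where
  "orderable G \<longleftrightarrow> (\<exists>r. group_order G r)"

definition positive_cone :: "('a, 'm) monoid_scheme \<Rightarrow> ('a \<times> 'a) set \<Rightarrow> 'a set" where
  "positive_cone G r = {g \<in> carrier G. (\<one>\<^bsub>G\<^esub>, g) \<in> r \<and> \<one>\<^bsub>G\<^esub> \<noteq> g}"


section \<open>Finite generation\<close>

definition fin_gen_group :: "('a, 'm) monoid_scheme \<Rightarrow> bool" where
  "fin_gen_group G \<longleftrightarrow> (\<exists>S. finite S \<and> S \<subseteq> carrier G \<and> generate G S = carrier G)"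

text \<open>Unlike \<^const>\<open>generate\<close>, this closes under products only.\<close>

inductive_set semigroup_generate :: "('a, 'm) monoid_scheme \<Rightarrow> 'a set \<Rightarrow> 'a set"
  for G and S where
    incl: "s \<in> S \<Longrightarrow> s \<in> semigroup_generate G S"
  | mult: "x \<in> semigroup_generate G S \<Longrightarrow> y \<in> semigroup_generate G S
           \<Longrightarrow> x \<otimes>\<^bsub>G\<^esub> y \<in> semigroup_generate G S"

definition fin_gen_semigroup :: "('a, 'm) monoid_scheme \<Rightarrow> 'a set \<Rightarrow> bool" where
  "fin_gen_semigroup G P \<longleftrightarrow> (\<exists>S. finite S \<and> S \<subseteq> P \<and> semigroup_generate G S = P)"


section \<open>Free products\<close>

text \<open>The free product is the monoid of words over the disjoint union of the two
  carriers, modulo the least congruence that makes both inclusions homomorphisms.\<close>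

definition fp_words :: "('a, 'm) monoid_scheme \<Rightarrow> ('b, 'n) monoid_scheme \<Rightarrow> ('a + 'b) list set" where
  "fp_words A B = lists (carrier A <+> carrier B)"

inductive_set fp_cong ::
    "('a, 'm) monoid_scheme \<Rightarrow> ('b, 'n) monoid_scheme \<Rightarrow> (('a + 'b) list \<times> ('a + 'b) list) set"
  for A and B where
    refl: "w \<in> fp_words A B \<Longrightarrow> (w, w) \<in> fp_cong A B"
  | sym: "(v, w) \<in> fp_cong A B \<Longrightarrow> (w, v) \<in> fp_cong A B"
  | trans: "(u, v) \<in> fp_cong A B \<Longrightarrow> (v, w) \<in> fp_cong A B \<Longrightarrow> (u, w) \<in> fp_cong A B"
  | append: "(v, v') \<in> fp_cong A B \<Longrightarrow> (w, w') \<in> fp_cong A B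
             \<Longrightarrow> (v @ w, v' @ w') \<in> fp_cong A B"
  | one_left: "([Inl \<one>\<^bsub>A\<^esub>], []) \<in> fp_cong A B"
  | one_right: "([Inr \<one>\<^bsub>B\<^esub>], []) \<in> fp_cong A B"
  | mult_left: "x \<in> carrier A \<Longrightarrow> y \<in> carrier A
             \<Longrightarrow> ([Inl x, Inl y], [Inl (x \<otimes>\<^bsub>A\<^esub> y)]) \<in> fp_cong A B"
  | mult_right: "x \<in> carrier B \<Longrightarrow> y \<in> carrier B
             \<Longrightarrow> ([Inr x, Inr y], [Inr (x \<otimes>\<^bsub>B\<^esub> y)]) \<in> fp_cong A B"

definition free_product ::
    "('a, 'm) monoid_scheme \<Rightarrow> ('b, 'n) monoid_scheme \<Rightarrow> ('a + 'b) list set monoid" where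
  "free_product A B =
     \<lparr> carrier = fp_words A B // fp_cong A B,
       mult = (\<lambda>X Y. \<Union>v \<in> X. \<Union>w \<in> Y. fp_cong A B `` {v @ w}),
       one = fp_cong A B `` {[]} \<rparr>"

definition fp_inl :: "('a, 'm) monoid_scheme \<Rightarrow> ('b, 'n) monoid_scheme \<Rightarrow> 'a \<Rightarrow> ('a + 'b) list set" where
  "fp_inl A B a = fp_cong A B `` {[Inl a]}"

definition fp_inr :: "('a, 'm) monoid_scheme \<Rightarrow> ('b, 'n) monoid_scheme \<Rightarrow> 'b \<Rightarrow> ('a + 'b) list set" where
  "fp_inr A B b = fp_cong A B `` {[Inr b]}"

subsection \<open>The free product is the coproduct of groups\<close>

lemma fp_words_simps [simp]:
  "[] \<in> fp_words A B"
  "Inl a # w \<in> fp_words A B \<longleftrightarrow> a \<in> carrier A \<and> w \<in> fp_words A B"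
  "Inr b # w \<in> fp_words A B \<longleftrightarrow> b \<in> carrier B \<and> w \<in> fp_words A B"
  "v @ w \<in> fp_words A B \<longleftrightarrow> v \<in> fp_words A B \<and> w \<in> fp_words A B"
  by (auto simp: fp_words_def)

locale two_groups = A: group A + B: group B
  for A :: "('a, 'm) monoid_scheme" and B :: "('b, 'n) monoid_scheme"
begin

lemma fp_cong_words: "(v, w) \<in> fp_cong A B \<Longrightarrow> v \<in> fp_words A B \<and> w \<in> fp_words A B"
  by (induction rule: fp_cong.induct) auto

lemma equiv_fp_cong: "equiv (fp_words A B) (fp_cong A B)"
  unfolding equiv_def
proof (intro conjI)
  show "fp_cong A B \<subseteq> fp_words A B \<times> fp_words A B"
    using fp_cong_words by auto
  show "refl_on (fp_words A B) (fp_cong A B)"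
    by (auto simp: refl_on_def intro: fp_cong.refl)
  show "sym_on UNIV (fp_cong A B)"
    by (auto intro!: symI intro: fp_cong.sym)
  show "trans_on UNIV (fp_cong A B)"
    by (auto intro!: transI intro: fp_cong.trans)
qed

lemma fp_class_eq:
  "v \<in> fp_words A B \<Longrightarrow> w \<in> fp_words A B \<Longrightarrow>
   fp_cong A B `` {v} = fp_cong A B `` {w} \<longleftrightarrow> (v, w) \<in> fp_cong A B"
  using eq_equiv_class_iff[OF equiv_fp_cong] by blast

lemma fp_mult_class:
  assumes "v \<in> fp_words A B" "w \<in> fp_words A B"
  shows "fp_cong A B `` {v} \<otimes>\<^bsub>free_product A B\<^esub> fp_cong A B `` {w} = fp_cong A B `` {v @ w}"
proof -
  have "congruent2 (fp_cong A B) (fp_cong A B) (\<lambda>v w. fp_cong A B `` {v @ w})"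
    by (rule congruent2I'[OF equiv_class_eq[OF equiv_fp_cong]]) (rule fp_cong.append)
  from UN_equiv_class2[OF equiv_fp_cong equiv_fp_cong this assms]
  show ?thesis by (simp add: free_product_def)
qed

lemma fp_carrier: "carrier (free_product A B) = (\<lambda>w. fp_cong A B `` {w}) ` fp_words A B"
  by (auto simp: free_product_def quotient_def)

lemma fp_one: "\<one>\<^bsub>free_product A B\<^esub> = fp_cong A B `` {[]}"
  by (simp add: free_product_def)

lemma fp_left_inverse:
  "w \<in> fp_words A B \<Longrightarrow> \<exists>v \<in> fp_words A B. (v @ w, []) \<in> fp_cong A B"
proof (induction w)
  case Nil
  then show ?case using fp_cong.refl[of "[]" A B] by force
next
  case (Cons s w)
  have "\<exists>s' \<in> carrier A <+> carrier B. ([s', s], []) \<in> fp_cong A B"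
  proof (cases s)
    case (Inl a)
    then have a: "a \<in> carrier A" using Cons.prems by simp
    have "([Inl (inv\<^bsub>A\<^esub> a), Inl a], []) \<in> fp_cong A B"
      using fp_cong.trans[OF fp_cong.mult_left[of "inv\<^bsub>A\<^esub> a" A a B]] a fp_cong.one_left[of A B]
      by simp
    then show ?thesis using Inl a by (metis A.inv_closed InlI)
  next
    case (Inr b)
    then have b: "b \<in> carrier B" using Cons.prems by simp
    have "([Inr (inv\<^bsub>B\<^esub> b), Inr b], []) \<in> fp_cong A B"
      using fp_cong.trans[OF fp_cong.mult_right[of "inv\<^bsub>B\<^esub> b" B b A]] b fp_cong.one_right[of B A]
      by simp
    then show ?thesis using Inr b by (metis B.inv_closed InrI)
  qed
  then obtain s' where s': "s' \<in> carrier A <+> carrier B" "([s', s], []) \<in> fp_cong A B" by blast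
  have w: "w \<in> fp_words A B" using Cons.prems by (auto simp: fp_words_def)
  with Cons.IH obtain v where v: "v \<in> fp_words A B" "(v @ w, []) \<in> fp_cong A B" by blast
  have "(v @ ([s', s] @ w), v @ ([] @ w)) \<in> fp_cong A B"
    by (intro fp_cong.append fp_cong.refl v w s')
  then have "((v @ [s']) @ s # w, []) \<in> fp_cong A B"
    using fp_cong.trans v(2) by fastforce
  moreover have "v @ [s'] \<in> fp_words A B" using v(1) s'(1) by (auto simp: fp_words_def)
  ultimately show ?case by blast
qed

theorem group_free_product: "group (free_product A B)"
proof (rule groupI)
  fix X Y assume "X \<in> carrier (free_product A B)" "Y \<in> carrier (free_product A B)"
  then show "X \<otimes>\<^bsub>free_product A B\<^esub> Y \<in> carrier (free_product A B)"
    by (auto simp: fp_carrier fp_mult_class)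
next
  fix X assume "X \<in> carrier (free_product A B)"
  then obtain w where w: "w \<in> fp_words A B" "X = fp_cong A B `` {w}"
    by (auto simp: fp_carrier)
  obtain v where "v \<in> fp_words A B" "(v @ w, []) \<in> fp_cong A B"
    using fp_left_inverse[OF w(1)] by blast
  then show "\<exists>Y \<in> carrier (free_product A B). Y \<otimes>\<^bsub>free_product A B\<^esub> X = \<one>\<^bsub>free_product A B\<^esub>"
    using w by (intro bexI[of _ "fp_cong A B `` {v}"])
      (auto simp: fp_mult_class fp_one fp_class_eq fp_carrier)
qed (auto simp: fp_carrier fp_mult_class fp_one)

lemma fp_inl_hom: "fp_inl A B \<in> hom A (free_product A B)"
  by (auto simp: hom_def fp_inl_def fp_carrier fp_mult_class fp_class_eq
      intro: fp_cong.sym[OF fp_cong.mult_left])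

lemma fp_inr_hom: "fp_inr A B \<in> hom B (free_product A B)"
  by (auto simp: hom_def fp_inr_def fp_carrier fp_mult_class fp_class_eq
      intro: fp_cong.sym[OF fp_cong.mult_right])

lemma fp_induct [consumes 1, case_names one inl inr]:
  assumes "X \<in> carrier (free_product A B)"
    and one: "P \<one>\<^bsub>free_product A B\<^esub>"
    and inl: "\<And>a Y. a \<in> carrier A \<Longrightarrow> Y \<in> carrier (free_product A B) \<Longrightarrow> P Y
              \<Longrightarrow> P (fp_inl A B a \<otimes>\<^bsub>free_product A B\<^esub> Y)"
    and inr: "\<And>b Y. b \<in> carrier B \<Longrightarrow> Y \<in> carrier (free_product A B) \<Longrightarrow> P Y
              \<Longrightarrow> P (fp_inr A B b \<otimes>\<^bsub>free_product A B\<^esub> Y)"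
  shows "P X"
proof -
  have "w \<in> fp_words A B \<Longrightarrow> P (fp_cong A B `` {w})" for w
  proof (induction w)
    case Nil
    then show ?case using one by (simp add: fp_one)
  next
    case (Cons s w)
    then have w: "w \<in> fp_words A B" by (auto simp: fp_words_def)
    then have "P (fp_cong A B `` {w})" "fp_cong A B `` {w} \<in> carrier (free_product A B)"
      using Cons.IH by (auto simp: fp_carrier)
    then show ?case
      using inl[of _ "fp_cong A B `` {w}"] inr[of _ "fp_cong A B `` {w}"] Cons.prems w
      by (cases s) (auto simp: fp_inl_def fp_inr_def fp_mult_class)
  qed
  then show ?thesis using assms(1) by (auto simp: fp_carrier)
qed

theorem free_product_universal:
  fixes H :: "('c, 'k) monoid_scheme"
  assumes "group H" and f: "f \<in> hom A H" and g: "g \<in> hom B H"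
  shows "\<exists>h \<in> hom (free_product A B) H.
           (\<forall>a \<in> carrier A. h (fp_inl A B a) = f a) \<and> (\<forall>b \<in> carrier B. h (fp_inr A B b) = g b)"
proof -
  interpret H: group H by fact
  interpret f: group_hom A H f using f by unfold_locales
  interpret g: group_hom B H g using g by unfold_locales
  define ev where "ev = (\<lambda>w. foldr (\<lambda>s y. case_sum f g s \<otimes>\<^bsub>H\<^esub> y) w \<one>\<^bsub>H\<^esub>)"
  have ev_Nil: "ev [] = \<one>\<^bsub>H\<^esub>" and ev_Cons: "ev (s # w) = case_sum f g s \<otimes>\<^bsub>H\<^esub> ev w" for s w
    by (simp_all add: ev_def)
  have ev_append_closed:
    "v \<in> fp_words A B \<Longrightarrow> w \<in> fp_words A B \<Longrightarrow>
     ev v \<in> carrier H \<and> ev w \<in> carrier H \<and> ev (v @ w) = ev v \<otimes>\<^bsub>H\<^esub> ev w" for v w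
  proof -
    have closed: "u \<in> fp_words A B \<Longrightarrow> ev u \<in> carrier H" for u
    proof (induction u)
      case (Cons s u) then show ?case by (cases s) (auto simp: ev_Cons)
    qed (simp add: ev_Nil)
    assume v: "v \<in> fp_words A B" and w: "w \<in> fp_words A B"
    from v have "ev (v @ w) = ev v \<otimes>\<^bsub>H\<^esub> ev w"
    proof (induction v)
      case Nil then show ?case using closed[OF w] by (simp add: ev_Nil)
    next
      case (Cons s v)
      then show ?case using closed[OF w] closed[of v]
        by (cases s) (auto simp: ev_Cons H.m_assoc)
    qed
    then show ?thesis using closed v w by blast
  qed
  have ev_cong: "(v, w) \<in> fp_cong A B \<Longrightarrow> ev v = ev w" for v w
  proof (induction rule: fp_cong.induct)
    case (append v v' w w')
    then show ?case using ev_append_closed fp_cong_words by metis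
  qed (auto simp: ev_Nil ev_Cons)
  define h where "h = (\<lambda>X. ev (SOME w. w \<in> X))"
  have h: "h (fp_cong A B `` {w}) = ev w" if "w \<in> fp_words A B" for w
  proof -
    have "w \<in> fp_cong A B `` {w}" using that by (auto intro: fp_cong.refl)
    then have "(SOME v. v \<in> fp_cong A B `` {w}) \<in> fp_cong A B `` {w}" by (rule someI)
    then show ?thesis using ev_cong unfolding h_def by auto
  qed
  have "h \<in> hom (free_product A B) H"
    using ev_append_closed by (auto simp: hom_def fp_carrier fp_mult_class h)
  then show ?thesis
    by (intro bexI[of _ h]) (auto simp: fp_inl_def fp_inr_def h ev_Nil ev_Cons)
qed

theorem free_product_universal_unique:
  fixes H :: "('c, 'k) monoid_scheme"
  assumes "group H" and h: "h \<in> hom (free_product A B) H" and k: "k \<in> hom (free_product A B) H"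
    and "\<And>a. a \<in> carrier A \<Longrightarrow> h (fp_inl A B a) = k (fp_inl A B a)"
    and "\<And>b. b \<in> carrier B \<Longrightarrow> h (fp_inr A B b) = k (fp_inr A B b)"
    and "X \<in> carrier (free_product A B)"
  shows "h X = k X"
  using assms(6)
proof (induction rule: fp_induct)
  case one
  then show ?case using hom_one[OF h group_free_product] hom_one[OF k group_free_product] assms(1)
    by simp
next
  case (inl a Y)
  then show ?case using hom_in_carrier[OF fp_inl_hom] assms(4) by (simp add: hom_mult[OF h] hom_mult[OF k])
next
  case (inr b Y)
  then show ?case using hom_in_carrier[OF fp_inr_hom] assms(5) by (simp add: hom_mult[OF h] hom_mult[OF k])
qed

end

end

theory Submission
  imports Defs "HOL-Library.Sublist"
begin

text \<open>
  The obstruction is that a finitely generated positive cone would be coarsely connected, while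
  the Cayley graph of a free product has cut vertices.  Suppose that a finite set \<open>S\<close> generates the
  cone \<open>P\<close> as a semigroup, and spell every generator as a word in the letters of \<open>A\<close> and \<open>B\<close>.
  A positive element is then spelled by a word each of whose suffixes represents \<open>k q\<close>, where \<open>k\<close>
  lies in the finite set \<open>K\<close> of suffixes of generators and \<open>q\<close> is positive or trivial
  (\<open>semigroup_generate_word\<close>).

  A finite set in a nontrivial ordered group has a strict lower bound, so some \<open>m\<close> lies below
  the identity and below \<open>K\<close> (\<open>finite_strict_lower_bound\<close>); no \<open>k q\<close> can be equal to \<open>m\<close>.  Put \<open>z = m\<inverse>\<close> and take a
  nontrivial \<open>c\<close> in the factor that does not contain the last syllable of \<open>z\<close>.  One of the
  conjugates \<open>z c z\<inverse>\<close> and \<open>z c\<inverse> z\<inverse>\<close> is positive; say \<open>g = z c z\<inverse>\<close>.  Multiplying \<open>z\<close> from the left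
  by the letters of a word for \<open>g\<close>, one at a time, leads from \<open>z\<close> to \<open>z c\<close>.  On the way the factor
  of the last syllable has to change, and a left multiplication by one letter cannot bring about
  this change except by passing through the identity (\<open>suffix_cancelling\<close>).  So some suffix of
  the word for \<open>g\<close> represents \<open>z\<inverse> = m\<close>, which is impossible.
\<close>

section \<open>Normal forms in a free product\<close>

context two_groups
begin

text \<open>
  Only letters of the same factor are ever multiplied; the last equation is a default value, chosen
  so that the product always lies in the factor of its first argument.
\<close>

fun letter_mult :: "'a + 'b \<Rightarrow> 'a + 'b \<Rightarrow> 'a + 'b" where
  "letter_mult (Inl x) (Inl y) = Inl (x \<otimes>\<^bsub>A\<^esub> y)"
| "letter_mult (Inr x) (Inr y) = Inr (x \<otimes>\<^bsub>B\<^esub> y)"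
| "letter_mult s t = s"

definition trivial_letter :: "'a + 'b \<Rightarrow> bool" where
  "trivial_letter s \<longleftrightarrow> s = Inl \<one>\<^bsub>A\<^esub> \<or> s = Inr \<one>\<^bsub>B\<^esub>"

definition reduced :: "('a + 'b) list \<Rightarrow> bool" where
  "reduced w \<longleftrightarrow> w \<in> fp_words A B \<and> (\<forall>s \<in> set w. \<not> trivial_letter s) \<and>
     successively (\<lambda>s t. isl s \<noteq> isl t) w"

text \<open>
  \<open>push s w\<close> is the reduced word for \<open>s w\<close> if \<open>w\<close> is reduced.  Except on a word with at most one
  letter, it does not touch the last letter; the cut-vertex argument rests on this.
\<close>

fun push :: "'a + 'b \<Rightarrow> ('a + 'b) list \<Rightarrow> ('a + 'b) list" where
  "push s [] = (if trivial_letter s then [] else [s])"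
| "push s (t # u) =
     (if trivial_letter s then t # u
      else if isl s \<noteq> isl t then s # t # u
      else if trivial_letter (letter_mult s t) then u
      else letter_mult s t # u)"

lemma in_Plus_simps [simp]:
  "Inl a \<in> X <+> Y \<longleftrightarrow> a \<in> X"
  "Inr b \<in> X <+> Y \<longleftrightarrow> b \<in> Y"
  by auto

lemma reduced_Nil [simp]: "reduced []"
  by (simp add: reduced_def)

lemma reduced_Cons:
  "reduced (s # w) \<longleftrightarrow> s \<in> carrier A <+> carrier B \<and> \<not> trivial_letter s \<and> reduced w \<and>
     (w = [] \<or> isl s \<noteq> isl (hd w))"
  by (cases w) (auto simp: reduced_def fp_words_def)

lemma isl_letter_mult [simp]: "isl (letter_mult s t) = isl s"
  by (cases s; cases t) auto

lemma letter_mult_closed: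
  "s \<in> carrier A <+> carrier B \<Longrightarrow> t \<in> carrier A <+> carrier B \<Longrightarrow>
   letter_mult s t \<in> carrier A <+> carrier B"
  by (cases s; cases t) auto

lemma letter_mult_assoc:
  "\<lbrakk>s \<in> carrier A <+> carrier B; t \<in> carrier A <+> carrier B; r \<in> carrier A <+> carrier B;
    isl s = isl t; isl t = isl r\<rbrakk> \<Longrightarrow>
   letter_mult (letter_mult s t) r = letter_mult s (letter_mult t r)"
  by (cases s; cases t; cases r) (auto simp: A.m_assoc B.m_assoc)

lemma letter_mult_trivial_left:
  "trivial_letter s \<Longrightarrow> t \<in> carrier A <+> carrier B \<Longrightarrow> isl s = isl t \<Longrightarrow> letter_mult s t = t"
  by (cases s; cases t) (auto simp: trivial_letter_def)

lemma letter_mult_trivial_right: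
  "trivial_letter t \<Longrightarrow> s \<in> carrier A <+> carrier B \<Longrightarrow> letter_mult s t = s"
  by (cases s; cases t) (auto simp: trivial_letter_def)

lemma letter_inverse:
  assumes "s \<in> carrier A <+> carrier B"
  obtains t where "t \<in> carrier A <+> carrier B" "isl t = isl s" "trivial_letter (letter_mult s t)"
    "trivial_letter t \<longleftrightarrow> trivial_letter s"
proof (cases s)
  case (Inl a)
  then show ?thesis using assms that[of "Inl (inv\<^bsub>A\<^esub> a)"]
    by (auto simp: trivial_letter_def A.inv_eq_1_iff)
next
  case (Inr b)
  then show ?thesis using assms that[of "Inr (inv\<^bsub>B\<^esub> b)"]
    by (auto simp: trivial_letter_def B.inv_eq_1_iff)
qed

lemma letter_mult_cong:
  "s \<in> carrier A <+> carrier B \<Longrightarrow> t \<in> carrier A <+> carrier B \<Longrightarrow> isl s = isl t \<Longrightarrow>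
   ([s, t], [letter_mult s t]) \<in> fp_cong A B"
  by (cases s; cases t) (auto intro: fp_cong.intros)

lemma trivial_letter_cong: "trivial_letter s \<Longrightarrow> ([s], []) \<in> fp_cong A B"
  by (auto simp: trivial_letter_def intro: fp_cong.intros)

lemma fp_cong_append_right:
  "(v, v') \<in> fp_cong A B \<Longrightarrow> w \<in> fp_words A B \<Longrightarrow> (v @ w, v' @ w) \<in> fp_cong A B"
  by (intro fp_cong.append fp_cong.refl)

lemma push_cong:
  assumes s: "s \<in> carrier A <+> carrier B" and w: "w \<in> fp_words A B"
  shows "(s # w, push s w) \<in> fp_cong A B"
proof (cases w)
  case Nil
  then show ?thesis using s trivial_letter_cong[of s]
    by (auto intro: fp_cong.refl simp: fp_words_def)
next
  case (Cons t u)
  then have t: "t \<in> carrier A <+> carrier B" and u: "u \<in> fp_words A B"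
    using w by (auto simp: fp_words_def)
  have sw: "(s # w, s # w) \<in> fp_cong A B"
    using s w by (intro fp_cong.refl) (auto simp: fp_words_def)
  have triv: "(s # w, w) \<in> fp_cong A B" if "trivial_letter s"
    using fp_cong_append_right[OF trivial_letter_cong[OF that] w] by simp
  have merge: "(s # t # u, letter_mult s t # u) \<in> fp_cong A B" if "isl s = isl t"
    using fp_cong_append_right[OF letter_mult_cong[OF s t that] u] by simp
  have drop: "(letter_mult s t # u, u) \<in> fp_cong A B" if "trivial_letter (letter_mult s t)"
    using fp_cong_append_right[OF trivial_letter_cong[OF that] u] by simp
  show ?thesis
    using sw triv merge drop fp_cong.trans unfolding Cons by auto
qed

lemma reduced_push:
  "s \<in> carrier A <+> carrier B \<Longrightarrow> reduced w \<Longrightarrow> reduced (push s w)"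
  by (cases w) (auto simp: reduced_Cons letter_mult_closed)

lemma reduced_foldr_push:
  "v \<in> fp_words A B \<Longrightarrow> reduced w \<Longrightarrow> reduced (foldr push v w)"
  by (induction v) (auto simp: fp_words_def intro: reduced_push)

lemma foldr_push_cong:
  "v \<in> fp_words A B \<Longrightarrow> reduced w \<Longrightarrow> (v @ w, foldr push v w) \<in> fp_cong A B"
proof (induction v)
  case Nil
  then show ?case by (auto simp: reduced_def intro: fp_cong.refl)
next
  case (Cons s v)
  then have s: "s \<in> carrier A <+> carrier B" and v: "v \<in> fp_words A B"
    by (auto simp: fp_words_def)
  have "([s] @ (v @ w), [s] @ foldr push v w) \<in> fp_cong A B"
    using Cons v s by (intro fp_cong.append fp_cong.refl) (auto simp: fp_words_def)
  moreover have "(s # foldr push v w, push s (foldr push v w)) \<in> fp_cong A B"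
    using push_cong[OF s] reduced_foldr_push[OF v Cons.prems(2)] by (simp add: reduced_def)
  ultimately show ?case using fp_cong.trans by fastforce
qed

text \<open>
  Pushing letters is an action of each factor on the set of reduced words.  The case that carries
  content is the one in which \<open>w\<close> starts with a letter of the same factor: there the claim is
  associativity, and when \<open>t\<close> cancels the first letter of \<open>w\<close>, the next letter comes from the other
  factor, so that \<open>s\<close> cannot interact with it.
\<close>

lemma push_push:
  assumes s: "s \<in> carrier A <+> carrier B" and t: "t \<in> carrier A <+> carrier B"
    and st: "isl s = isl t" and w: "reduced w"
  shows "push s (push t w) = push (letter_mult s t) w"
proof -
  consider "trivial_letter s" | "trivial_letter t"
    | "\<not> trivial_letter s" "\<not> trivial_letter t" "w = [] \<or> isl t \<noteq> isl (hd w)"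
    | r u where "\<not> trivial_letter s" "\<not> trivial_letter t" "w = r # u" "isl t = isl r"
    by (cases w) auto
  then show ?thesis
  proof cases
    case 1
    moreover have "push s v = v" for v using 1 by (cases v) auto
    ultimately show ?thesis using letter_mult_trivial_left t st by simp
  next
    case 2
    moreover have "push t v = v" for v using 2 by (cases v) auto
    ultimately show ?thesis using letter_mult_trivial_right s st by simp
  next
    case 3
    then show ?thesis using st by (cases w) auto
  next
    case 4
    then have r: "r \<in> carrier A <+> carrier B" and nr: "\<not> trivial_letter r"
      and u: "u = [] \<or> isl r \<noteq> isl (hd u)"
      using w by (auto simp: reduced_Cons)
    have assoc: "letter_mult (letter_mult s t) r = letter_mult s (letter_mult t r)"
      using letter_mult_assoc[OF s t r] st 4 by simp
    show ?thesis
    proof (cases "trivial_letter (letter_mult t r)")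
      case True
      then have "letter_mult (letter_mult s t) r = s"
        using assoc letter_mult_trivial_right s by simp
      moreover have "push s u = s # u" using u st 4 by (cases u) auto
      moreover have "letter_mult (letter_mult s t) r = r" if "trivial_letter (letter_mult s t)"
        using letter_mult_trivial_left[OF that r] st 4 by simp
      ultimately show ?thesis using 4 st True by auto
    next
      case False
      have "letter_mult (letter_mult s t) r = r" if "trivial_letter (letter_mult s t)"
        using letter_mult_trivial_left[OF that r] st 4 by simp
      then show ?thesis using 4 st False assoc nr by auto
    qed
  qed
qed

text \<open>
  Van der Waerden's argument: since both factors act on the reduced words by pushing, so does
  their free product, and congruent words must act in the same way.
\<close>

lemma foldr_push_invariant:
  "(v, v') \<in> fp_cong A B \<Longrightarrow> reduced w \<Longrightarrow> foldr push v w = foldr push v' w"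
proof (induction arbitrary: w rule: fp_cong.induct)
  case (append v v' u u')
  have "reduced (foldr push u w)"
    using append fp_cong_words reduced_foldr_push by metis
  then show ?case using append by simp
next
  case one_left
  then show ?case by (cases w) (auto simp: trivial_letter_def)
next
  case one_right
  then show ?case by (cases w) (auto simp: trivial_letter_def)
next
  case (mult_left x y)
  then show ?case using push_push[of "Inl x" "Inl y" w] by simp
next
  case (mult_right x y)
  then show ?case using push_push[of "Inr x" "Inr y" w] by simp
qed auto

lemma foldr_push_reduced: "reduced w \<Longrightarrow> foldr push w [] = w"
proof (induction w)
  case (Cons s w)
  then show ?case by (cases w) (auto simp: reduced_Cons)
qed simp

lemma reduced_cong_unique:
  "reduced v \<Longrightarrow> reduced w \<Longrightarrow> (v, w) \<in> fp_cong A B \<Longrightarrow> v = w"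
  using foldr_push_invariant[of v w "[]"] foldr_push_reduced by simp

lemma reduced_snoc:
  assumes "reduced z" "z \<noteq> []" "c \<in> carrier A <+> carrier B" "\<not> trivial_letter c"
    "isl c \<noteq> isl (last z)"
  shows "reduced (z @ [c])"
  using assms by (auto simp: reduced_def fp_words_def successively_append_iff)

section \<open>The identity as a cut vertex\<close>

lemma isl_last_push:
  "w \<noteq> [] \<Longrightarrow> push s w \<noteq> [] \<Longrightarrow> isl (last (push s w)) = isl (last w)"
  by (cases w) (auto split: if_splits)

text \<open>
  As long as the process does not reach the empty word, the last letter may be multiplied by other
  letters of its factor, but it cannot be replaced by a letter of the other factor.
\<close>

lemma isl_last_foldr_push:
  "z \<noteq> [] \<Longrightarrow> (\<And>u. suffix u w \<Longrightarrow> foldr push u z \<noteq> []) \<Longrightarrow>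
   isl (last (foldr push w z)) = isl (last z)"
proof (induction w)
  case (Cons s w)
  have "foldr push u z \<noteq> []" if "suffix u w" for u
    using Cons.prems(2) that by (simp add: suffix_ConsI)
  then show ?case
    using Cons isl_last_push[of "foldr push w z" s] Cons.prems(2)[of "s # w"] by auto
qed simp

text \<open>
  The cut-vertex property.  Removing the identity from the Cayley graph with respect to the letters
  separates the elements whose last syllable is in \<open>A\<close> from those whose last syllable is in \<open>B\<close>.
  The suffixes of \<open>w\<close> describe a path from \<open>z\<close> to \<open>z c\<close>, which lie on different sides.
\<close>

lemma suffix_cancelling:
  assumes z: "reduced z" "z \<noteq> []"
    and c: "c \<in> carrier A <+> carrier B" "\<not> trivial_letter c" "isl c \<noteq> isl (last z)"
    and w: "w \<in> fp_words A B" and wz: "(w @ z, z @ [c]) \<in> fp_cong A B"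
  obtains u where "suffix u w" "(u @ z, []) \<in> fp_cong A B"
proof -
  have "foldr push w z = z @ [c]"
    using foldr_push_invariant[OF wz, of "[]"] z(1) reduced_snoc[OF z c]
    by (metis foldr_append foldr_push_reduced reduced_Nil)
  then have "isl (last (foldr push w z)) \<noteq> isl (last z)"
    using c by simp
  then obtain u where u: "suffix u w" "foldr push u z = []"
    using isl_last_foldr_push[OF z(2)] by metis
  moreover have "u \<in> fp_words A B"
    using u(1) w by (auto simp: suffix_def)
  ultimately show thesis using foldr_push_cong z(1) that by metis
qed

end

section \<open>Positive cones\<close>

context group
begin

lemma positive_cone_closed: "positive_cone G r \<subseteq> carrier G"
  by (auto simp: positive_cone_def)

lemma one_notin_positive_cone: "\<one> \<notin> positive_cone G r"
  by (simp add: positive_cone_def)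

lemma positive_cone_mult:
  assumes r: "group_order G r" and x: "x \<in> positive_cone G r" and y: "y \<in> positive_cone G r"
  shows "x \<otimes> y \<in> positive_cone G r"
proof -
  have lin: "linear_order_on (carrier G) r"
    and inv: "\<And>g g' h. \<lbrakk>g \<in> carrier G; g' \<in> carrier G; h \<in> carrier G; (g, g') \<in> r\<rbrakk>
                \<Longrightarrow> (h \<otimes> g, h \<otimes> g') \<in> r"
    using r by (auto simp: group_order_def)
  have x': "x \<in> carrier G" "(\<one>, x) \<in> r" "\<one> \<noteq> x" and y': "y \<in> carrier G" "(\<one>, y) \<in> r" "\<one> \<noteq> y"
    using x y by (auto simp: positive_cone_def)
  have xy: "(x, x \<otimes> y) \<in> r" using inv[OF _ y'(1) x'(1) y'(2)] x'(1) by simp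
  have tr: "trans r" and an: "antisym r"
    using lin by (auto simp: order_on_defs)
  have "(\<one>, x \<otimes> y) \<in> r" using tr x'(2) xy by (rule transD)
  moreover have "\<one> \<noteq> x \<otimes> y" using an x' xy by (metis antisymD)
  ultimately show ?thesis using x' y' by (simp add: positive_cone_def)
qed

lemma positive_cone_cases:
  assumes r: "group_order G r" and x: "x \<in> carrier G" "x \<noteq> \<one>"
  shows "x \<in> positive_cone G r \<or> inv x \<in> positive_cone G r"
proof -
  have "(\<one>, x) \<in> r \<or> (x, \<one>) \<in> r"
    using r x by (auto simp: group_order_def order_on_defs total_on_def)
  moreover have "(\<one>, inv x) \<in> r" if "(x, \<one>) \<in> r"
  proof -
    have "(inv x \<otimes> x, inv x \<otimes> \<one>) \<in> r"
      using r x that unfolding group_order_def by blast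
    then show ?thesis using x by simp
  qed
  moreover have "\<one> \<noteq> inv x" using x by (metis inv_eq_1_iff)
  ultimately show ?thesis using x unfolding positive_cone_def by auto
qed

text \<open>
  The condition says \<open>m < k\<close> for all \<open>k\<close> in \<open>K\<close>.  If \<open>m\<close> is below \<open>K\<close> but not below a further
  element \<open>k0\<close>, then \<open>k0 \<le> m\<close>, and for any positive \<open>p\<close> the element \<open>k0 p\<inverse>\<close> is below \<open>k0\<close>, hence
  below all of \<open>K\<close> as well.
\<close>

lemma finite_strict_lower_bound:
  assumes r: "group_order G r" and nontriv: "positive_cone G r \<noteq> {}"
    and "finite K" "K \<subseteq> carrier G"
  shows "\<exists>m \<in> carrier G. \<forall>k \<in> K. inv m \<otimes> k \<in> positive_cone G r"
  using assms(3,4)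
proof (induction K)
  case (insert k0 K)
  then obtain m where m: "m \<in> carrier G" "\<And>k. k \<in> K \<Longrightarrow> inv m \<otimes> k \<in> positive_cone G r"
    by auto
  have k0: "k0 \<in> carrier G" using insert by simp
  show ?case
  proof (cases "inv m \<otimes> k0 \<in> positive_cone G r")
    case True
    then show ?thesis using m by auto
  next
    case False
    obtain p where p: "p \<in> positive_cone G r" "p \<in> carrier G"
      using nontriv positive_cone_closed by blast
    have "inv m \<otimes> k0 = \<one> \<or> inv k0 \<otimes> m \<in> positive_cone G r"
      using positive_cone_cases[OF r, of "inv m \<otimes> k0"] False m(1) k0
      by (auto simp: inv_mult_group)
    then have le: "p \<otimes> (inv k0 \<otimes> m) \<in> positive_cone G r"
    proof
      assume "inv m \<otimes> k0 = \<one>"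
      then have "m = k0" using m(1) k0 by (metis inv_equality inv_inv inv_closed)
      then show ?thesis using p k0 by simp
    qed (use positive_cone_mult[OF r p(1)] in auto)
    have inv_new: "inv (k0 \<otimes> inv p) = p \<otimes> inv k0"
      using p k0 by (simp add: inv_mult_group)
    have "inv (k0 \<otimes> inv p) \<otimes> k \<in> positive_cone G r" if "k \<in> insert k0 K" for k
    proof (cases "k = k0")
      case True
      then show ?thesis using p k0 inv_new by (simp add: m_assoc)
    next
      case False
      then have k: "k \<in> K" "k \<in> carrier G" using that insert by auto
      have "inv (k0 \<otimes> inv p) \<otimes> k = (p \<otimes> (inv k0 \<otimes> m)) \<otimes> (inv m \<otimes> k)"
        using p k0 m(1) k inv_solve_left[of "inv m \<otimes> k" m k] inv_new
        by (simp add: m_assoc inv_solve_left)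
      then show ?thesis using positive_cone_mult[OF r le m(2)] k by simp
    qed
    then show ?thesis using p k0 by (intro bexI[of _ "k0 \<otimes> inv p"]) auto
  qed
qed auto

end

section \<open>Positive cones of free products\<close>

context two_groups
begin

abbreviation (input) word_class :: "('a + 'b) list \<Rightarrow> ('a + 'b) list set" where
  "word_class w \<equiv> fp_cong A B `` {w}"

text \<open>
  Cutting a product of generators at an arbitrary letter leaves on the right a suffix of one
  generator, followed by a product of whole generators, which is positive when the generators are.
  The empty product is the reason for adding the identity.
\<close>

lemma semigroup_generate_word:
  assumes x: "x \<in> semigroup_generate (free_product A B) S"
    and P: "semigroup_generate (free_product A B) S \<subseteq> carrier (free_product A B)"
    and spell: "\<And>s. s \<in> S \<Longrightarrow> spell s \<in> fp_words A B \<and> word_class (spell s) = s"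
  shows "\<exists>w \<in> fp_words A B. word_class w = x \<and>
           (\<forall>u. suffix u w \<longrightarrow>
              (\<exists>k \<in> word_class ` (\<Union>s \<in> S. {u. suffix u (spell s)}).
                 \<exists>q \<in> insert \<one>\<^bsub>free_product A B\<^esub> (semigroup_generate (free_product A B) S).
                   word_class u = k \<otimes>\<^bsub>free_product A B\<^esub> q))"
    (is "\<exists>w \<in> _. _ \<and> (\<forall>u. _ \<longrightarrow> ?factors u)")
  using x
proof (induction rule: semigroup_generate.induct)
  interpret G: group "free_product A B" by (rule group_free_product)
  {
    case (incl s)
    have "?factors u" if u: "suffix u (spell s)" for u
    proof -
      have "u \<in> fp_words A B" using u spell[OF incl] by (auto simp: suffix_def)
      then have "word_class u \<otimes>\<^bsub>free_product A B\<^esub> \<one>\<^bsub>free_product A B\<^esub> = word_class u"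
        by (simp add: fp_carrier)
      then show ?thesis using u incl by blast
    qed
    then show ?case using spell[OF incl] by blast
  next
    case (mult x y)
    obtain v where v: "v \<in> fp_words A B" "word_class v = x" "\<And>u. suffix u v \<Longrightarrow> ?factors u"
      using mult.IH(1) by blast
    obtain w where w: "w \<in> fp_words A B" "word_class w = y" "\<And>u. suffix u w \<Longrightarrow> ?factors u"
      using mult.IH(2) by blast
    have "?factors u" if u: "suffix u (v @ w)" for u
    proof (cases "suffix u w")
      case False
      then obtain u' where u': "u = u' @ w" "suffix u' v"
        using u by (auto simp: suffix_append)
      then have u'_word: "u' \<in> fp_words A B" using v(1) by (auto simp: suffix_def)
      obtain k q where k: "k \<in> word_class ` (\<Union>s \<in> S. {u. suffix u (spell s)})"
        and q: "q \<in> insert \<one>\<^bsub>free_product A B\<^esub> (semigroup_generate (free_product A B) S)"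
        and kq: "word_class u' = k \<otimes>\<^bsub>free_product A B\<^esub> q"
        using v(3)[OF u'(2)] by blast
      have kc: "k \<in> carrier (free_product A B)"
        using k spell by (fastforce simp: fp_carrier suffix_def)
      have "q \<in> carrier (free_product A B)" "y \<in> carrier (free_product A B)"
        using q mult P by auto
      then have "word_class u = k \<otimes>\<^bsub>free_product A B\<^esub> (q \<otimes>\<^bsub>free_product A B\<^esub> y)"
        using fp_mult_class[OF u'_word w(1)] kq kc w(2) u'(1) by (simp add: G.m_assoc)
      moreover have "q \<otimes>\<^bsub>free_product A B\<^esub> y \<in> semigroup_generate (free_product A B) S"
        using q mult P by (auto intro: semigroup_generate.mult)
      ultimately show ?thesis using k by blast
    qed (use w(3) in blast)
    moreover have "word_class (v @ w) = x \<otimes>\<^bsub>free_product A B\<^esub> y"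
      using fp_mult_class v w by metis
    ultimately show ?case using v(1) w(1) by (intro bexI[of _ "v @ w"]) auto
  }
qed

lemma reduced_representative:
  assumes "X \<in> carrier (free_product A B)"
  obtains z where "reduced z" "word_class z = X"
proof -
  obtain w where w: "w \<in> fp_words A B" "X = word_class w"
    using assms by (auto simp: fp_carrier)
  have "(w, foldr push w []) \<in> fp_cong A B" "reduced (foldr push w [])"
    using foldr_push_cong[OF w(1), of "[]"] reduced_foldr_push[OF w(1), of "[]"] by auto
  then show thesis using that w equiv_class_eq[OF equiv_fp_cong] by metis
qed

lemma letter_class_nontrivial:
  assumes "c \<in> carrier A <+> carrier B" "\<not> trivial_letter c"
  shows "word_class [c] \<noteq> \<one>\<^bsub>free_product A B\<^esub>"
proof
  assume "word_class [c] = \<one>\<^bsub>free_product A B\<^esub>"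
  then have "([c], []) \<in> fp_cong A B"
    using assms fp_class_eq[of "[c]" "[]"] by (simp add: fp_one fp_words_def)
  then show False using reduced_cong_unique[of "[c]" "[]"] assms by (simp add: reduced_Cons)
qed

text \<open>
  The letter \<open>c\<close> may be replaced by its inverse, which lies in the same factor; this is how the
  conjugate of \<open>c\<close> by \<open>z\<close> is made positive.
\<close>

lemma positive_conjugate_of_letter:
  assumes r: "group_order (free_product A B) r" and z: "reduced z"
    and c: "c \<in> carrier A <+> carrier B" "\<not> trivial_letter c"
  obtains c' g where "c' \<in> carrier A <+> carrier B" "\<not> trivial_letter c'" "isl c' = isl c"
    "g \<in> positive_cone (free_product A B) r"
    "g \<otimes>\<^bsub>free_product A B\<^esub> word_class z = word_class (z @ [c'])"
proof -
  interpret G: group "free_product A B" by (rule group_free_product)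
  let ?Z = "word_class z"
  obtain d where d: "d \<in> carrier A <+> carrier B" "isl d = isl c"
    "trivial_letter (letter_mult c d)" "\<not> trivial_letter d"
    using letter_inverse[OF c(1)] c(2) by metis
  have word: "z \<in> fp_words A B" "[c] \<in> fp_words A B" "[d] \<in> fp_words A B"
    using z c d by (auto simp: reduced_def fp_words_def)
  then have carr: "?Z \<in> carrier (free_product A B)" "word_class [c] \<in> carrier (free_product A B)"
    "word_class [d] \<in> carrier (free_product A B)"
    by (auto simp: fp_carrier)
  define conj where "conj = (\<lambda>x. ?Z \<otimes>\<^bsub>free_product A B\<^esub> x \<otimes>\<^bsub>free_product A B\<^esub> inv\<^bsub>free_product A B\<^esub> ?Z)"
  have conj_mult: "conj (word_class [x]) \<otimes>\<^bsub>free_product A B\<^esub> ?Z = word_class (z @ [x])"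
    if "[x] \<in> fp_words A B" for x
  proof -
    have "conj X \<otimes>\<^bsub>free_product A B\<^esub> ?Z = ?Z \<otimes>\<^bsub>free_product A B\<^esub> X"
      if "X \<in> carrier (free_product A B)" for X
      using carr that by (simp add: conj_def G.m_assoc)
    moreover have "word_class [x] \<in> carrier (free_product A B)"
      unfolding fp_carrier using that by (rule imageI)
    ultimately show ?thesis
      using fp_mult_class[OF word(1) that] by metis
  qed
  have "([c, d], []) \<in> fp_cong A B"
    using letter_mult_cong[of c d] trivial_letter_cong d c fp_cong.trans by metis
  then have cd: "word_class [c] \<otimes>\<^bsub>free_product A B\<^esub> word_class [d] = \<one>\<^bsub>free_product A B\<^esub>"
    using fp_mult_class[OF word(2,3)] equiv_class_eq[OF equiv_fp_cong] by (simp add: fp_one)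
  then have "word_class [d] = inv\<^bsub>free_product A B\<^esub> word_class [c]"
    using carr by (metis G.inv_equality G.inv_inv G.inv_closed)
  then have inv_conj: "inv\<^bsub>free_product A B\<^esub> conj (word_class [c]) = conj (word_class [d])"
    using carr by (simp add: conj_def G.inv_mult_group G.m_assoc)
  have "conj (word_class [c]) \<noteq> \<one>\<^bsub>free_product A B\<^esub>"
  proof
    assume "conj (word_class [c]) = \<one>\<^bsub>free_product A B\<^esub>"
    then have "?Z \<otimes>\<^bsub>free_product A B\<^esub> word_class [c] = ?Z"
      using carr conj_mult[OF word(2)] fp_mult_class[OF word(1,2)] by simp
    then show False
      using carr letter_class_nontrivial[OF c] by (simp add: G.l_cancel_one)
  qed
  moreover have "conj (word_class [c]) \<in> carrier (free_product A B)"
    using carr by (simp add: conj_def)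
  ultimately have "conj (word_class [c]) \<in> positive_cone (free_product A B) r \<or>
      conj (word_class [d]) \<in> positive_cone (free_product A B) r"
    using G.positive_cone_cases[OF r] unfolding inv_conj[symmetric] by blast
  then show thesis
  proof
    assume "conj (word_class [c]) \<in> positive_cone (free_product A B) r"
    then show thesis using c conj_mult[OF word(2)] by (intro that[of c]) simp_all
  next
    assume "conj (word_class [d]) \<in> positive_cone (free_product A B) r"
    then show thesis by (rule that[OF d(1,4,2) _ conj_mult[OF word(3)]])
  qed
qed

theorem positive_cone_not_fin_gen_semigroup:
  assumes A: "carrier A \<noteq> {\<one>\<^bsub>A\<^esub>}" and B: "carrier B \<noteq> {\<one>\<^bsub>B\<^esub>}"
    and r: "group_order (free_product A B) r"
  shows "\<not> fin_gen_semigroup (free_product A B) (positive_cone (free_product A B) r)"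
proof
  interpret G: group "free_product A B" by (rule group_free_product)
  let ?G = "free_product A B" and ?P = "positive_cone (free_product A B) r"
  assume "fin_gen_semigroup ?G ?P"
  then obtain S where S: "finite S" "semigroup_generate ?G S = ?P" "S \<subseteq> ?P"
    by (auto simp: fin_gen_semigroup_def)
  have "\<forall>s \<in> S. \<exists>w. w \<in> fp_words A B \<and> word_class w = s"
    using S(3) G.positive_cone_closed by (fastforce simp: fp_carrier)
  then obtain spell where spell: "\<And>s. s \<in> S \<Longrightarrow> spell s \<in> fp_words A B \<and> word_class (spell s) = s"
    by metis
  define K where "K = word_class ` (\<Union>s \<in> S. {u. suffix u (spell s)})"
  have "finite {u. suffix u w}" for w :: "('a + 'b) list"
    by (metis List.finite_set set_suffixes_eq)
  then have K_fin: "finite K" using S(1) by (simp add: K_def)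
  have K_carr: "K \<subseteq> carrier ?G"
    using spell by (fastforce simp: K_def fp_carrier suffix_def)
  have letter: "\<exists>c \<in> carrier A <+> carrier B. \<not> trivial_letter c \<and> isl c = i" for i
  proof (cases i)
    case True
    then obtain a where "a \<in> carrier A" "a \<noteq> \<one>\<^bsub>A\<^esub>" using A by blast
    then show ?thesis using True by (intro bexI[of _ "Inl a"]) (auto simp: trivial_letter_def)
  next
    case False
    then obtain b where "b \<in> carrier B" "b \<noteq> \<one>\<^bsub>B\<^esub>" using B by blast
    then show ?thesis using False by (intro bexI[of _ "Inr b"]) (auto simp: trivial_letter_def)
  qed
  \<comment> \<open>The empty word serves as \<open>z\<close> here: some letter or its inverse is positive.\<close>
  have "?P \<noteq> {}"
    using letter positive_conjugate_of_letter[OF r, of "[]"] by (metis empty_iff reduced_Nil)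
  \<comment> \<open>Being below the identity makes \<open>m\<close> nontrivial, so that its inverse has a last syllable.\<close>
  then have "\<exists>m \<in> carrier ?G. \<forall>k \<in> insert \<one>\<^bsub>?G\<^esub> K. inv\<^bsub>?G\<^esub> m \<otimes>\<^bsub>?G\<^esub> k \<in> ?P"
    using K_fin K_carr by (intro G.finite_strict_lower_bound[OF r]) auto
  then obtain m where m: "m \<in> carrier ?G" "\<And>k. k \<in> insert \<one>\<^bsub>?G\<^esub> K \<Longrightarrow> inv\<^bsub>?G\<^esub> m \<otimes>\<^bsub>?G\<^esub> k \<in> ?P"
    by blast
  obtain z where z: "reduced z" "word_class z = inv\<^bsub>?G\<^esub> m"
    using reduced_representative m(1) by (metis G.inv_closed)
  have z_word: "z \<in> fp_words A B" using z(1) by (simp add: reduced_def)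
  have "inv\<^bsub>?G\<^esub> m \<in> ?P" using m(1) m(2)[of "\<one>\<^bsub>?G\<^esub>"] by simp
  then have "z \<noteq> []" using z(2) G.one_notin_positive_cone by (auto simp: fp_one)
  obtain c g where c: "c \<in> carrier A <+> carrier B" "\<not> trivial_letter c" "isl c \<noteq> isl (last z)"
    and g: "g \<in> ?P" "g \<otimes>\<^bsub>?G\<^esub> word_class z = word_class (z @ [c])"
    using letter[of "\<not> isl (last z)"] positive_conjugate_of_letter[OF r z(1)] by metis
  obtain w where w: "w \<in> fp_words A B" "word_class w = g"
    and w_suffix: "\<And>u. suffix u w \<Longrightarrow>
      \<exists>k \<in> K. \<exists>q \<in> insert \<one>\<^bsub>?G\<^esub> ?P. word_class u = k \<otimes>\<^bsub>?G\<^esub> q"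
    using semigroup_generate_word[of g S spell] g(1) S(2) G.positive_cone_closed spell
    unfolding K_def by auto
  have "word_class (w @ z) = word_class (z @ [c])"
    using g(2) fp_mult_class[OF w(1) z_word] w(2) by simp
  then have "(w @ z, z @ [c]) \<in> fp_cong A B"
    using fp_class_eq w(1) z_word c(1) by (auto simp: fp_words_def)
  then obtain u where u: "suffix u w" "(u @ z, []) \<in> fp_cong A B"
    using suffix_cancelling[OF z(1) \<open>z \<noteq> []\<close> c w(1)] by blast
  have u_word: "u \<in> fp_words A B" using u(1) w(1) by (auto simp: suffix_def)
  then have "word_class u \<otimes>\<^bsub>?G\<^esub> inv\<^bsub>?G\<^esub> m = \<one>\<^bsub>?G\<^esub>"
    using fp_mult_class[OF u_word z_word] z(2) u(2) equiv_class_eq[OF equiv_fp_cong]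
    by (simp add: fp_one)
  moreover have "word_class u \<in> carrier ?G"
    unfolding fp_carrier using u_word by (rule imageI)
  ultimately have um: "inv\<^bsub>?G\<^esub> m \<otimes>\<^bsub>?G\<^esub> word_class u = \<one>\<^bsub>?G\<^esub>"
    by (rule G.inv_comm[OF _ _ G.inv_closed[OF m(1)]])
  \<comment> \<open>The suffix \<open>u\<close> represents \<open>m\<close>, but \<open>m < k \<le> k q\<close> whenever \<open>k\<close> is in \<open>K\<close> and \<open>q\<close> is not negative.\<close>
  obtain k q where kq: "k \<in> K" "q \<in> insert \<one>\<^bsub>?G\<^esub> ?P" "word_class u = k \<otimes>\<^bsub>?G\<^esub> q"
    using w_suffix[OF u(1)] by blast
  have "k \<in> carrier ?G" "q \<in> carrier ?G"
    using kq K_carr G.positive_cone_closed by auto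
  then have "(inv\<^bsub>?G\<^esub> m \<otimes>\<^bsub>?G\<^esub> k) \<otimes>\<^bsub>?G\<^esub> q = \<one>\<^bsub>?G\<^esub>"
    using um kq(3) m(1) by (simp add: G.m_assoc)
  moreover have "(inv\<^bsub>?G\<^esub> m \<otimes>\<^bsub>?G\<^esub> k) \<otimes>\<^bsub>?G\<^esub> q \<in> ?P"
    using m kq(1,2) \<open>k \<in> carrier ?G\<close> G.positive_cone_mult[OF r] by auto
  ultimately show False using G.one_notin_positive_cone by metis
qed

end

theorem corollary2:
  fixes A :: "('a, 'm) monoid_scheme" and B :: "('b, 'n) monoid_scheme"
  assumes "group A" and "group B"
    and "carrier A \<noteq> {\<one>\<^bsub>A\<^esub>}" and "carrier B \<noteq> {\<one>\<^bsub>B\<^esub>}"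
    and "fin_gen_group A" and "fin_gen_group B"
    and "orderable A" and "orderable B"
  shows "\<not> (\<exists>r. group_order (free_product A B) r \<and>
                fin_gen_semigroup (free_product A B) (positive_cone (free_product A B) r))"
proof -
  interpret two_groups A B
    using assms(1,2) by (intro two_groups.intro)
  show ?thesis
    using positive_cone_not_fin_gen_semigroup[OF assms(3,4)] by blast
qed

end
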